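(* Let $(\Omega,\mu)$ be a probability space, let $2<p<\infty$, $1\le q<\infty$, and let $X_N\subset L_p(\Omega,\mu)$ be an $N$-dimensional subspace such that, for some constant $M$, $\|f\|_p\le M\|f\|_2$ for all $f\in X_N$. Suppose that $X_N$ has an orthonormal basis $\{u_i\}_{i=1}^N$ (with respect to the inner product of $L_2(\Omega,\mu)$) with the property $\sum_{i=1}^N|u_i(\omega)|^2\ge cN$ for all $\omega\in\Omega$, where $c>0$. Let $m\in\mathbb N$, $D>0$, and assume that there are points $\xi^1,\dots,\xi^m\in\Omega$ (not necessarily distinct) such that $$\left(\frac1m\sum_{j=1}^m|f(\xi^j)|^q\right)^{1/q}\le D\|f\|_p\qquad\text{for all } f\in X_N.$$ Then $$(cN)^{q/2}\le m(DM)^q.$$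
   Context: Functions are measurable and defined at every point of $\Omega$ (functions differing on a set of measure zero are not identified). $\|f\|_p=\left(\int_\Omega|f|^p\,d\mu\right)^{1/p}$. *)

theory Defs
  imports "HOL-Probability.Probability" "HOL-Library.Function_Algebras"
begin

text \<open>
  Scalar fields, so that real and complex function spaces are treated by one statement.
  Up to isomorphism the only instances are the reals and the complex numbers, and the
  axioms determine \<open>scnj\<close>.
\<close>

class rc_scalar = real_normed_field + euclidean_space +
  fixes scnj :: "'a \<Rightarrow> 'a"
  assumes scnj_add: "scnj (x + y) = scnj x + scnj y"
    and scnj_mult: "scnj (x * y) = scnj x * scnj y"
    and scnj_scnj: "scnj (scnj x) = x"
    and mult_scnj: "x * scnj x = ((norm x)\<^sup>2) *\<^sub>R 1"

instantiation real :: rc_scalar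
begin
definition scnj_real :: "real \<Rightarrow> real" where "scnj_real x = x"
instance
  by standard (simp_all add: scnj_real_def power2_eq_square)
end

instantiation complex :: rc_scalar
begin
definition scnj_complex :: "complex \<Rightarrow> complex" where "scnj_complex z = cnj z"
instance
  by standard (simp_all add: scnj_complex_def scaleR_conv_of_real complex_norm_square del: of_real_power)
end

definition fun_scale :: "'k::field \<Rightarrow> ('a \<Rightarrow> 'k) \<Rightarrow> 'a \<Rightarrow> 'k"
  where "fun_scale c f = (\<lambda>x. c * f x)"

global_interpretation fun_space: vector_space fun_scale
  by standard (auto simp: fun_scale_def fun_eq_iff algebra_simps)

definition Lp_norm :: "'a measure \<Rightarrow> real \<Rightarrow> ('a \<Rightarrow> 'k::rc_scalar) \<Rightarrow> real"
  where "Lp_norm \<mu> p f = (LINT x|\<mu>. norm (f x) powr p) powr (1 / p)"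

text \<open>
  Functions are not identified when equal almost everywhere.  A function on
  \<^term>\<open>space \<mu>\<close> is represented by its unique extension by zero to the whole
  type, so linear independence and dimension depend only on values in \<^term>\<open>space \<mu>\<close>.
\<close>

definition Lp_space :: "'a measure \<Rightarrow> real \<Rightarrow> ('a \<Rightarrow> 'k::rc_scalar) set"
  where "Lp_space \<mu> p =
    {f \<in> borel_measurable \<mu>. (\<forall>x. x \<notin> space \<mu> \<longrightarrow> f x = 0) \<and>
       integrable \<mu> (\<lambda>x. norm (f x) powr p)}"

definition L2_inner :: "'a measure \<Rightarrow> ('a \<Rightarrow> 'k::rc_scalar) \<Rightarrow> ('a \<Rightarrow> 'k) \<Rightarrow> 'k"
  where "L2_inner \<mu> f g = (LINT x|\<mu>. f x * scnj (g x))"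

definition L2_orthonormal_basis ::
    "'a measure \<Rightarrow> ('a \<Rightarrow> 'k::rc_scalar) set \<Rightarrow> nat \<Rightarrow> (nat \<Rightarrow> 'a \<Rightarrow> 'k) \<Rightarrow> bool"
  where "L2_orthonormal_basis \<mu> X N u \<longleftrightarrow>
    inj_on u {1..N} \<and>
    fun_space.independent (u ` {1..N}) \<and>
    fun_space.span (u ` {1..N}) = X \<and>
    (\<forall>i\<in>{1..N}. \<forall>j\<in>{1..N}. L2_inner \<mu> (u i) (u j) = (if i = j then 1 else 0))"

end

theory Submission
  imports Defs
begin

text \<open>
  Fix a sample point \<open>\<xi> 1\<close> and test the discretization inequality on the reproducing kernel
  \<open>f = (\<Sum>i. scnj (u i (\<xi> 1)) * u i)\<close>. With \<open>S = (\<Sum>i. (norm (u i (\<xi> 1)))\<^sup>2)\<close> one has \<open>f (\<xi> 1) = S\<close>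
  while \<open>f\<close> has \<open>L\<^sub>2\<close> norm \<open>sqrt S\<close>. Keeping only the first summand of the discrete norm gives
  \<open>S powr q / m \<le> (D * M * sqrt S) powr q\<close>, and \<open>S \<ge> c * N\<close>.
\<close>

lemma scnj_zero [simp]: "scnj 0 = (0 :: 'k::rc_scalar)"
  using scnj_add[of 0 "0 :: 'k"] by simp

text \<open>Taking norms in \<open>mult_scnj\<close> gives
  \<open>norm x * norm (scnj x) = (norm x)\<^sup>2\<close>; for nonzero \<open>x\<close> one factor
  cancels.\<close>

lemma norm_scnj [simp]: "norm (scnj x) = norm (x :: 'k::rc_scalar)"
proof (cases "x = 0")
  case False
  have "norm x * norm (scnj x) = (norm x)\<^sup>2"
    using arg_cong[OF mult_scnj[of x], of norm] by (simp add: norm_mult)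
  with False show ?thesis by (simp add: power2_eq_square)
qed simp

lemma scnj_diff: "scnj (x - y) = scnj x - scnj (y :: 'k::rc_scalar)"
  using scnj_add[of "x - y" y] by (simp add: algebra_simps)

lemma scnj_sum: "scnj (\<Sum>i\<in>A. f i) = (\<Sum>i\<in>A. scnj (f i :: 'k::rc_scalar))"
proof (induction A rule: infinite_finite_induct)
  case (insert a A)
  then show ?case by (simp add: scnj_add)
qed simp_all

text \<open>Being additive and norm preserving, \<open>scnj\<close> is an isometry, so \<delta> =
  \<epsilon> works. Measurability of the inner product integrand rests on this.\<close>

lemma continuous_on_scnj: "continuous_on A (scnj :: 'k::rc_scalar \<Rightarrow> 'k)"
  by (intro continuous_onI exI) (auto simp: dist_norm simp flip: scnj_diff intro: less_imp_le)

lemma borel_measurable_scnj [measurable]: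
  "(scnj :: 'k::rc_scalar \<Rightarrow> 'k) \<in> borel_measurable borel"
  by (intro borel_measurable_continuous_onI continuous_on_scnj)

text \<open>Domination by \<open>1 + norm (f x) powr p\<close>, where the constant 1 is integrable
  because the measure is finite.\<close>

lemma Lp_space_square_integrable:
  assumes "finite_measure \<mu>" and "2 \<le> p" and "f \<in> Lp_space \<mu> p"
  shows "integrable \<mu> (\<lambda>x. (norm (f x))\<^sup>2)"
proof (rule Bochner_Integration.integrable_bound)
  interpret finite_measure \<mu> by fact
  have [measurable]: "f \<in> borel_measurable \<mu>"
    using assms(3) by (auto simp: Lp_space_def)
  show "integrable \<mu> (\<lambda>x. 1 + norm (f x) powr p)"
    using assms(3) by (auto simp: Lp_space_def)
  show "(\<lambda>x. (norm (f x))\<^sup>2) \<in> borel_measurable \<mu>"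
    by measurable
  have "t\<^sup>2 \<le> 1 + t powr p" if "t \<ge> 0" for t :: real
  proof (cases "t \<le> 1")
    case True
    then have "t\<^sup>2 \<le> 1" using that by (simp add: power_le_one)
    then show ?thesis by (simp add: add_increasing2)
  next
    case False
    then have "t powr 2 \<le> t powr p" using assms(2) by (intro powr_mono) auto
    with False show ?thesis by simp
  qed
  then show "AE x in \<mu>. norm ((norm (f x))\<^sup>2) \<le> norm (1 + norm (f x) powr p)"
    by simp
qed

text \<open>Since \<open>scnj\<close> preserves norms, the elementary bound
  \<open>a * b \<le> a\<^sup>2 + b\<^sup>2\<close> supplies an integrable majorant.\<close>

lemma integrable_mult_scnj:
  fixes f g :: "'a \<Rightarrow> 'k::rc_scalar"
  assumes [measurable]: "f \<in> borel_measurable \<mu>" "g \<in> borel_measurable \<mu>"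
    and "integrable \<mu> (\<lambda>x. (norm (f x))\<^sup>2)" and "integrable \<mu> (\<lambda>x. (norm (g x))\<^sup>2)"
  shows "integrable \<mu> (\<lambda>x. f x * scnj (g x))"
proof (rule Bochner_Integration.integrable_bound)
  show "integrable \<mu> (\<lambda>x. (norm (f x))\<^sup>2 + (norm (g x))\<^sup>2)"
    using assms by simp
  have "a * b \<le> a\<^sup>2 + b\<^sup>2" for a b :: real
    using sum_squares_bound[of a b] zero_le_power2[of a] zero_le_power2[of b]
      zero_le_power2[of "a + b"] by (simp add: power2_sum)
  then show "AE x in \<mu>. norm (f x * scnj (g x)) \<le> norm ((norm (f x))\<^sup>2 + (norm (g x))\<^sup>2)"
    by (simp add: norm_mult)
qed measurable

lemma Lp_norm_nonneg: "0 \<le> Lp_norm \<mu> p f"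
  by (simp add: Lp_norm_def)

lemma Lp_norm_2: "Lp_norm \<mu> 2 f = sqrt (LINT x|\<mu>. (norm (f x))\<^sup>2)"
  by (simp add: Lp_norm_def powr_half_sqrt)

lemma sum_fun_scale_apply: "(\<Sum>i\<in>I. fun_scale (a i) (u i)) x = (\<Sum>i\<in>I. a i * u i x)"
  by (induction I rule: infinite_finite_induct) (simp_all add: fun_scale_def)

text \<open>Parseval's identity: \<open>f x * scnj (f x)\<close> expands into a double sum, and
  after integration orthonormality leaves only the diagonal.\<close>

lemma Lp_norm_2_orthonormal_sum:
  fixes u :: "'i \<Rightarrow> 'a \<Rightarrow> 'k::rc_scalar"
  assumes "finite I"
    and meas [measurable]: "\<And>i. i \<in> I \<Longrightarrow> u i \<in> borel_measurable \<mu>"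
    and int: "\<And>i. i \<in> I \<Longrightarrow> integrable \<mu> (\<lambda>x. (norm (u i x))\<^sup>2)"
    and orth: "\<And>i j. i \<in> I \<Longrightarrow> j \<in> I \<Longrightarrow> L2_inner \<mu> (u i) (u j) = (if i = j then 1 else 0)"
  shows "Lp_norm \<mu> 2 (\<Sum>i\<in>I. fun_scale (a i) (u i)) = sqrt (\<Sum>i\<in>I. (norm (a i))\<^sup>2)"
proof -
  define f where "f = (\<Sum>i\<in>I. fun_scale (a i) (u i))"
  have f: "f x = (\<Sum>i\<in>I. a i * u i x)" for x
    by (simp add: f_def sum_fun_scale_apply)
  have uu: "integrable \<mu> (\<lambda>x. u i x * scnj (u j x))" if "i \<in> I" "j \<in> I" for i j
    using that by (intro integrable_mult_scnj meas int)
  have ff: "f x * scnj (f x) = (\<Sum>i\<in>I. \<Sum>j\<in>I. (a i * scnj (a j)) * (u i x * scnj (u j x)))" for x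
    by (simp add: f scnj_sum scnj_mult sum_product mult_ac)
  have int_ff: "integrable \<mu> (\<lambda>x. f x * scnj (f x))"
    unfolding ff using uu by (intro Bochner_Integration.integrable_sum integrable_mult_right)
  have "(LINT x|\<mu>. f x * scnj (f x))
      = (\<Sum>i\<in>I. \<Sum>j\<in>I. (a i * scnj (a j)) * L2_inner \<mu> (u i) (u j))"
    unfolding ff L2_inner_def using uu
    by (simp add: Bochner_Integration.integral_sum)
  also have "\<dots> = (\<Sum>i\<in>I. a i * scnj (a i))"
  proof (rule sum.cong)
    fix i assume "i \<in> I"
    then have "(\<Sum>j\<in>I. (a i * scnj (a j)) * L2_inner \<mu> (u i) (u j))
        = (\<Sum>j\<in>I. if i = j then a i * scnj (a j) else 0)"
      by (intro sum.cong) (simp_all add: orth)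
    then show "(\<Sum>j\<in>I. (a i * scnj (a j)) * L2_inner \<mu> (u i) (u j)) = a i * scnj (a i)"
      using \<open>i \<in> I\<close> \<open>finite I\<close> by simp
  qed simp
  \<comment> \<open>This is still an identity in \<open>'k\<close>. Integrability of the real
    function, shown next, lets the vector 1 be pulled out of the integral, so that real coefficients
    can be compared.\<close>
  finally have eq: "(LINT x|\<mu>. (norm (f x))\<^sup>2 *\<^sub>R (1::'k)) = (\<Sum>i\<in>I. (norm (a i))\<^sup>2) *\<^sub>R 1"
    by (simp add: mult_scnj scaleR_sum_left)
  have "integrable \<mu> (\<lambda>x. norm (f x * scnj (f x)))"
    using int_ff by (rule integrable_norm)
  then have "integrable \<mu> (\<lambda>x. (norm (f x))\<^sup>2)"
    by (simp add: norm_mult power2_eq_square)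
  with eq have "(LINT x|\<mu>. (norm (f x))\<^sup>2) = (\<Sum>i\<in>I. (norm (a i))\<^sup>2)"
    by simp
  then show ?thesis
    by (simp add: Lp_norm_2 flip: f_def)
qed

theorem proposition2p1:
  fixes \<mu> :: "'a measure" and X :: "('a \<Rightarrow> 'k::rc_scalar) set"
    and u :: "nat \<Rightarrow> 'a \<Rightarrow> 'k" and \<xi> :: "nat \<Rightarrow> 'a"
    and p q M c D :: real and N m :: nat
  assumes "prob_space \<mu>"
    and "2 < p" and "1 \<le> q"
    and "X \<subseteq> Lp_space \<mu> p"
    and "fun_space.subspace X" and "fun_space.dim X = N"
    and "\<forall>f\<in>X. Lp_norm \<mu> p f \<le> M * Lp_norm \<mu> 2 f"
    and "L2_orthonormal_basis \<mu> X N u"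
    and "c > 0"
    and "\<forall>\<omega>\<in>space \<mu>. (\<Sum>i=1..N. (norm (u i \<omega>))\<^sup>2) \<ge> c * real N"
    and "m \<ge> 1" and "D > 0"
    and "\<forall>j\<in>{1..m}. \<xi> j \<in> space \<mu>"
    and "\<forall>f\<in>X. ((1 / real m) * (\<Sum>j=1..m. norm (f (\<xi> j)) powr q)) powr (1 / q)
           \<le> D * Lp_norm \<mu> p f"
  shows "(c * real N) powr (q / 2) \<le> real m * (D * M) powr q"
proof (cases "N = 0")
  \<comment> \<open>For \<open>N = 0\<close> the left-hand side is
    \<open>0 powr (q / 2) = 0\<close>. For \<open>N > 0\<close> the lower bound makes
    \<open>S\<close> positive, which later permits division by a power of \<open>S\<close>.\<close>
  case False
  interpret prob_space \<mu> by fact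
  define \<omega> where "\<omega> = \<xi> 1"
  define S where "S = (\<Sum>i=1..N. (norm (u i \<omega>))\<^sup>2)"
  define f where "f = (\<Sum>i=1..N. fun_scale (scnj (u i \<omega>)) (u i))"
  have "\<omega> \<in> space \<mu>"
    using assms(11,13) by (simp add: \<omega>_def)
  then have "c * real N \<le> S"
    using assms(10) by (simp add: S_def)
  moreover have cN: "c * real N > 0"
    using False assms(9) by simp
  ultimately have S: "S > 0" by linarith
  have span: "fun_space.span (u ` {1..N}) = X"
    and orth: "\<And>i j. i \<in> {1..N} \<Longrightarrow> j \<in> {1..N} \<Longrightarrow>
      L2_inner \<mu> (u i) (u j) = (if i = j then 1 else 0)"
    using assms(8) by (auto simp: L2_orthonormal_basis_def)
  have u: "u i \<in> Lp_space \<mu> p" if "i \<in> {1..N}" for i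
    using that span assms(4) fun_space.span_base[of "u i" "u ` {1..N}"] by blast
  have fX: "f \<in> X"
    unfolding f_def span[symmetric]
    by (intro fun_space.span_sum fun_space.span_scale fun_space.span_base imageI)
  \<comment> \<open>The conjugated coefficients turn each summand at \<open>\<omega>\<close> into a
    squared norm.\<close>
  have "f \<omega> = S *\<^sub>R 1"
    by (simp add: f_def S_def sum_fun_scale_apply mult.commute[of "scnj _"] mult_scnj scaleR_sum_left)
  then have norm_f: "norm (f (\<xi> 1)) = S"
    using S by (simp add: \<omega>_def)
  have "Lp_norm \<mu> 2 f = sqrt (\<Sum>i=1..N. (norm (scnj (u i \<omega>)))\<^sup>2)"
    unfolding f_def
  proof (rule Lp_norm_2_orthonormal_sum)
    show "u i \<in> borel_measurable \<mu>" if "i \<in> {1..N}" for i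
      using u[OF that] by (simp add: Lp_space_def)
    show "integrable \<mu> (\<lambda>x. (norm (u i x))\<^sup>2)" if "i \<in> {1..N}" for i
      using u[OF that] assms(2)
      by (intro Lp_space_square_integrable[of \<mu> p] finite_measure_axioms) simp_all
  qed (simp_all add: orth)
  then have "Lp_norm \<mu> p f \<le> M * sqrt S"
    using assms(7)[rule_format, OF fX] by (simp add: S_def)
  \<comment> \<open>A negative \<open>M\<close> would make \<open>M * sqrt S\<close> negative, while
    it bounds a norm from above. The sign is used when \<open>powr\<close> is distributed over
    \<open>D * (M * sqrt S)\<close>.\<close>
  moreover from this have "M \<ge> 0"
    using S Lp_norm_nonneg[of \<mu> p f] by (smt (verit) mult_neg_pos real_sqrt_gt_zero)
  moreover have "((1 / real m) * S powr q) powr (1 / q)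
      \<le> ((1 / real m) * (\<Sum>j=1..m. norm (f (\<xi> j)) powr q)) powr (1 / q)"
    using assms(3,11) member_le_sum[of 1 "{1..m}" "\<lambda>j. norm (f (\<xi> j)) powr q"] norm_f
    by (intro powr_mono2 mult_left_mono) auto
  moreover note assms(14)[rule_format, OF fX]
  ultimately have "((1 / real m) * S powr q) powr (1 / q) \<le> D * (M * sqrt S)"
    using assms(12) by (smt (verit) mult_left_mono)
  \<comment> \<open>Raising to the power \<open>q\<close> removes the outer root on the left and
    turns \<open>sqrt S\<close> into \<open>S powr (q / 2)\<close> on the right.\<close>
  then have "(((1 / real m) * S powr q) powr (1 / q)) powr q \<le> (D * (M * sqrt S)) powr q"
    using assms(3) by (intro powr_mono2) auto
  then have "S powr q / real m \<le> (D * M) powr q * S powr (q / 2)"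
    using assms(3,11,12) \<open>M \<ge> 0\<close> S
    by (simp add: powr_powr powr_mult mult.assoc flip: powr_half_sqrt)
  \<comment> \<open>Splitting the power exposes the positive factor \<open>S powr (q / 2)\<close>
    common to both sides, which then cancels.\<close>
  moreover have "S powr q = S powr (q / 2) * S powr (q / 2)"
    by (simp flip: powr_add)
  ultimately have "S powr (q / 2) \<le> real m * (D * M) powr q"
    using assms(11) S by (simp add: field_simps)
  moreover have "(c * real N) powr (q / 2) \<le> S powr (q / 2)"
    using \<open>c * real N \<le> S\<close> cN assms(3) by (intro powr_mono2) auto
  ultimately show ?thesis by linarith
qed simp

end
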